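(* Let $m\ge 3$ be an integer. Then every subgroup of a finite $m$PCI-group is $m$PCI.
   Context: Graphs are finite and simple, and are viewed as digraphs with symmetric arc sets. For a finite group $G$, $V=\bigcup_{i=1}^m G_i$ is a disjoint union of copies $G_i=\{x_i:x\in G\}$ of $G$. For subsets $S_{i,j}\subseteq G$ ($1\le i,j\le m$) with $S_{i,i}=\emptyset$ for all $i$ and $S_{i,j}=S_{j,i}^{-1}$ for all $i,j$, the $m$-PCayley graph $\mathrm{Cay}(G,S_{i,j}:1\le i,j\le m)$ of $G$ has vertex set $V$ and arc set $\bigcup_{i,j}\{(x_i,(sx)_j): s\in S_{i,j},x\in G\}$. $R(G)=\{R(g):g\in G\}$ with $R(g):x_i\mapsto(xg)_i$ for all $x\in G$ and all $i$, and $N=N_{\mathrm{S}_V}(R(G))$ is its normalizer in the symmetric group on $V$. For a permutation $n$ of $V$, $\Gamma^n$ is the graph with vertex set $V$ and arcs $(u^n,v^n)$ for $(u,v)$ an arc of $\Gamma$. An $m$-PCayley graph $\Gamma$ of $G$ is $m$PCI if for every $m$-PCayley graph $\Sigma$ of $G$ for which there is an isomorphism from $\Gamma$ to $\Sigma$ mapping each $G_i$ onto some $G_j$, there is $n\in N$ with $\Gamma^n=\Sigma$. The group $G$ is $m$PCI (an $m$PCI-group) if every $m$-PCayley graph of $G$ is $m$PCI. *)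

theory Defs
  imports
    "HOL-Algebra.Group_Action"
    "HOL-Algebra.Bij"
    "Graph_Theory.Pair_Digraph"
begin

text \<open>The element \<open>x\<^sub>i\<close> of the \<open>i\<close>-th copy of a group \<open>G\<close> is the pair \<open>(x, i)\<close>.\<close>

definition copy :: "('a, 'b) monoid_scheme \<Rightarrow> nat \<Rightarrow> ('a \<times> nat) set" where
  "copy G i = {(x, i) | x. x \<in> carrier G}"

definition copies :: "nat \<Rightarrow> ('a, 'b) monoid_scheme \<Rightarrow> ('a \<times> nat) set" where
  "copies m G = (\<Union>i\<in>{1..m}. copy G i)"

definition connection_family ::
    "nat \<Rightarrow> ('a, 'b) monoid_scheme \<Rightarrow> (nat \<Rightarrow> nat \<Rightarrow> 'a set) \<Rightarrow> bool" where
  "connection_family m G S \<longleftrightarrow>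
     (\<forall>i\<in>{1..m}. \<forall>j\<in>{1..m}. S i j \<subseteq> carrier G) \<and>
     (\<forall>i\<in>{1..m}. S i i = {}) \<and>
     (\<forall>i\<in>{1..m}. \<forall>j\<in>{1..m}. S i j = (\<lambda>s. inv\<^bsub>G\<^esub> s) ` S j i)"

definition Cay ::
    "nat \<Rightarrow> ('a, 'b) monoid_scheme \<Rightarrow> (nat \<Rightarrow> nat \<Rightarrow> 'a set) \<Rightarrow> ('a \<times> nat) pair_pre_digraph" where
  "Cay m G S =
     \<lparr> pverts = copies m G,
       parcs = (\<Union>i\<in>{1..m}. \<Union>j\<in>{1..m}.
                  {((x, i), (s \<otimes>\<^bsub>G\<^esub> x, j)) | s x. s \<in> S i j \<and> x \<in> carrier G}) \<rparr>"

definition mPCayley_graph ::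
    "nat \<Rightarrow> ('a, 'b) monoid_scheme \<Rightarrow> ('a \<times> nat) pair_pre_digraph \<Rightarrow> bool" where
  "mPCayley_graph m G \<Gamma> \<longleftrightarrow> (\<exists>S. connection_family m G S \<and> \<Gamma> = Cay m G S)"

lemma mPCayley_graph_imp_pair_graph:
  assumes "group G" "finite (carrier G)" "mPCayley_graph m G \<Gamma>"
  shows "pair_graph \<Gamma>"
proof -
  interpret group G by fact
  obtain S where S: "connection_family m G S" and \<Gamma>: "\<Gamma> = Cay m G S"
    using assms(3) by (auto simp: mPCayley_graph_def)
  have mem: "s \<in> carrier G" if "i \<in> {1..m}" "j \<in> {1..m}" "s \<in> S i j" for i j s
    using S that unfolding connection_family_def by blast
  have arcs: "parcs \<Gamma> \<subseteq> pverts \<Gamma> \<times> pverts \<Gamma>"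
    by (auto simp: \<Gamma> Cay_def copies_def copy_def intro!: m_closed mem)
  have "copies m G \<subseteq> carrier G \<times> {1..m}"
    by (auto simp: copies_def copy_def)
  then have fin: "finite (pverts \<Gamma>)"
    using assms(2) by (auto simp: \<Gamma> Cay_def intro: finite_subset)
  have sym: "(v, u) \<in> parcs \<Gamma>" if uv: "(u, v) \<in> parcs \<Gamma>" for u v
  proof -
    obtain x i s j where *: "i \<in> {1..m}" "j \<in> {1..m}" "s \<in> S i j" "x \<in> carrier G"
      "u = (x, i)" "v = (s \<otimes>\<^bsub>G\<^esub> x, j)"
      using uv by (auto simp: \<Gamma> Cay_def)
    have "inv\<^bsub>G\<^esub> s \<in> S j i"
      using S *(1,2,3) unfolding connection_family_def by blast
    moreover have "s \<otimes>\<^bsub>G\<^esub> x \<in> carrier G" "x = inv\<^bsub>G\<^esub> s \<otimes>\<^bsub>G\<^esub> (s \<otimes>\<^bsub>G\<^esub> x)"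
      using mem[OF *(1-3)] *(4) by (simp_all add: m_assoc[symmetric])
    ultimately show ?thesis
      using *(1,2,5,6) unfolding \<Gamma> Cay_def by auto
  qed
  have loop: "u \<noteq> v" if "(u, v) \<in> parcs \<Gamma>" for u v
  proof -
    have "S i i = {}" if "i \<in> {1..m}" for i
      using S that unfolding connection_family_def by blast
    then show ?thesis
      using that by (auto simp: \<Gamma> Cay_def)
  qed
  have "finite (parcs \<Gamma>)"
    using arcs fin by (meson finite_SigmaI finite_subset)
  then show ?thesis
    using arcs fin loop
    by unfold_locales (auto simp: symmetric_def intro!: symI dest: sym)
qed

text \<open>
  Permutations of \<open>V\<close> are the elements of \<^term>\<open>carrier (BijGroup V)\<close>: they are extensional
  functions, composed from right to left. The set of maps \<open>R(g)\<close> and its normalizer do not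
  depend on the order of composition.
\<close>

definition right_mult :: "nat \<Rightarrow> ('a, 'b) monoid_scheme \<Rightarrow> 'a \<Rightarrow> 'a \<times> nat \<Rightarrow> 'a \<times> nat" where
  "right_mult m G g = (\<lambda>(x, i)\<in>copies m G. (x \<otimes>\<^bsub>G\<^esub> g, i))"

definition right_regular :: "nat \<Rightarrow> ('a, 'b) monoid_scheme \<Rightarrow> ('a \<times> nat \<Rightarrow> 'a \<times> nat) set" where
  "right_regular m G = right_mult m G ` carrier G"

lemma right_regular_subset:
  assumes "group G"
  shows "right_regular m G \<subseteq> carrier (BijGroup (copies m G))"
proof -
  interpret group G by fact
  have "bij_betw (right_mult m G g) (copies m G) (copies m G)" if "g \<in> carrier G" for g
    by (rule bij_betwI[where g = "right_mult m G (inv\<^bsub>G\<^esub> g)"])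
       (use that in \<open>auto simp: right_mult_def copies_def copy_def m_assoc\<close>)
  then show ?thesis
    by (auto simp: right_regular_def BijGroup_def Bij_def right_mult_def)
qed

definition image_graph :: "('v \<Rightarrow> 'w) \<Rightarrow> 'v pair_pre_digraph \<Rightarrow> 'w pair_pre_digraph" where
  "image_graph n \<Gamma> = \<lparr> pverts = n ` pverts \<Gamma>, parcs = {(n u, n v) | u v. (u, v) \<in> parcs \<Gamma>} \<rparr>"

definition graph_isomorphism ::
    "('v \<Rightarrow> 'w) \<Rightarrow> 'v pair_pre_digraph \<Rightarrow> 'w pair_pre_digraph \<Rightarrow> bool" where
  "graph_isomorphism f \<Gamma> \<Sigma> \<longleftrightarrow>
     bij_betw f (pverts \<Gamma>) (pverts \<Sigma>) \<and>
     (\<forall>u\<in>pverts \<Gamma>. \<forall>v\<in>pverts \<Gamma>. (u, v) \<in> parcs \<Gamma> \<longleftrightarrow> (f u, f v) \<in> parcs \<Sigma>)"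

definition mPCI_graph ::
    "nat \<Rightarrow> ('a, 'b) monoid_scheme \<Rightarrow> ('a \<times> nat) pair_pre_digraph \<Rightarrow> bool" where
  "mPCI_graph m G \<Gamma> \<longleftrightarrow>
     (\<forall>\<Sigma>. mPCayley_graph m G \<Sigma> \<and>
          (\<exists>f. graph_isomorphism f \<Gamma> \<Sigma> \<and>
               (\<forall>i\<in>{1..m}. \<exists>j\<in>{1..m}. f ` copy G i = copy G j))
        \<longrightarrow> (\<exists>n\<in>normalizer (BijGroup (copies m G)) (right_regular m G). image_graph n \<Gamma> = \<Sigma>))"

definition mPCI_group :: "nat \<Rightarrow> ('a, 'b) monoid_scheme \<Rightarrow> bool" where
  "mPCI_group m G \<longleftrightarrow> (\<forall>\<Gamma>. mPCayley_graph m G \<Gamma> \<longrightarrow> mPCI_graph m G \<Gamma>)"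

end

theory Submission
  imports Defs
begin

text \<open>
  Let \<open>\<Gamma>\<close> and \<open>\<Sigma>\<close> be isomorphic \<open>m\<close>-partite Cayley graphs of the subgroup \<open>H\<close>, with connection
  families \<open>S\<close> and \<open>T\<close>. The same families, read in \<open>G\<close>, define graphs \<open>\<Gamma>'\<close> and \<open>\<Sigma>'\<close> that consist of
  one disjoint translate of \<open>\<Gamma>\<close>, respectively \<open>\<Sigma>\<close>, for each right coset of \<open>H\<close>. Repeating an
  isomorphism \<open>\<Gamma> \<rightarrow> \<Sigma>\<close> on every coset gives an isomorphism \<open>\<Gamma>' \<rightarrow> \<Sigma>'\<close>
  (\<open>coset_extension_isomorphism\<close>), so the hypothesis on \<open>G\<close> provides \<open>n\<close> in the normalizer of \<open>R(G)\<close>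
  with \<open>\<Gamma>'\<close> mapped onto \<open>\<Sigma>'\<close>.

  Suppose \<open>\<Gamma>\<close> is connected. Then \<open>n\<close> maps the component \<open>\<Gamma>\<close> of \<open>\<Gamma>'\<close> into a single translate of
  \<open>\<Sigma>\<close>, and after composing with some \<open>R(x)\<close>, an automorphism of \<open>\<Sigma>'\<close>, into \<open>\<Sigma>\<close> itself. The
  restriction of this map to the copies of \<open>H\<close> carries \<open>\<Gamma>\<close> to \<open>\<Sigma>\<close>. It normalizes \<open>R(H)\<close>: it
  conjugates \<open>R(h)\<close> to some \<open>R(g)\<close> with \<open>g\<close> in \<open>G\<close>, and since both the map and \<open>R(h)\<close> preserve the
  copies of \<open>H\<close>, so does \<open>R(g)\<close>, which forces \<open>g \<in> H\<close> (\<open>cut_connected_imp_mPCI_graph\<close>).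

  If \<open>\<Gamma>\<close> is disconnected, it is replaced by its multipartite complement, in which two vertices of
  distinct parts are adjacent iff they are not adjacent in \<open>\<Gamma>\<close>. Part-preserving isomorphisms and
  elements of the normalizer are compatible with complementation, so the property transfers back to \<open>\<Gamma>\<close>
  (\<open>mPCI_graph_of_co_connection\<close>). This is where \<open>m \<ge> 3\<close> enters: with at least three parts, a graph
  of this kind or its multipartite complement is connected
  (\<open>multipartite_or_complement_cut_connected\<close>), while two disjoint copies of \<open>K\<^bsub>n,n\<^esub>\<close>, placed so that
  the parts have size \<open>2n\<close>, show that this fails for two parts.
\<close>

section \<open>The normalizer of the right regular representation\<close>

text \<open>
  For a finite subset, being mapped into itself under conjugation already means being mapped onto
  itself, so normalizing can be checked without inverses.
\<close>

lemma (in group) normalizer_iff: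
  assumes K: "K \<subseteq> carrier G" and fin: "finite K"
  shows "g \<in> normalizer G K \<longleftrightarrow> g \<in> carrier G \<and> (\<forall>k\<in>K. \<exists>k'\<in>K. g \<otimes> k = k' \<otimes> g)"
proof -
  have conj: "g <# K #> inv g = (\<lambda>k. g \<otimes> k \<otimes> inv g) ` K"
    by (auto simp: l_coset_def r_coset_def)
  have "(\<lambda>k. g \<otimes> k \<otimes> inv g) ` K = K \<longleftrightarrow> (\<forall>k\<in>K. \<exists>k'\<in>K. g \<otimes> k = k' \<otimes> g)"
    if g: "g \<in> carrier G"
  proof -
    have iff: "g \<otimes> k \<otimes> inv g = k' \<longleftrightarrow> g \<otimes> k = k' \<otimes> g" if "k \<in> K" "k' \<in> K" for k k'
      using that g K inv_solve_right' m_closed by (metis subsetD)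
    have "inj_on (\<lambda>k. g \<otimes> k \<otimes> inv g) K"
      using K g by (auto intro!: inj_onI simp: subset_iff)
    then have "(\<lambda>k. g \<otimes> k \<otimes> inv g) ` K = K \<longleftrightarrow> (\<lambda>k. g \<otimes> k \<otimes> inv g) ` K \<subseteq> K"
      using fin by (metis endo_inj_surj order_refl)
    also have "\<dots> \<longleftrightarrow> (\<forall>k\<in>K. \<exists>k'\<in>K. g \<otimes> k \<otimes> inv g = k')"
      by auto
    also have "\<dots> \<longleftrightarrow> (\<forall>k\<in>K. \<exists>k'\<in>K. g \<otimes> k = k' \<otimes> g)"
      using iff by (metis (no_types, lifting))
    finally show ?thesis .
  qed
  then show ?thesis
    using K by (auto simp: normalizer_def stabilizer_def conj)
qed

lemma mem_copies_iff: "u \<in> copies m G \<longleftrightarrow> fst u \<in> carrier G \<and> snd u \<in> {1..m}"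
  by (cases u) (auto simp: copies_def copy_def)

lemma finite_copies: "finite (carrier G) \<Longrightarrow> finite (copies m G)"
  by (rule finite_subset[of _ "carrier G \<times> {1..m}"]) (auto simp: mem_copies_iff)

lemma right_mult_eq:
  "u \<in> copies m G \<Longrightarrow> right_mult m G g u = (fst u \<otimes>\<^bsub>G\<^esub> g, snd u)"
  by (cases u) (simp add: right_mult_def)

text \<open>
  The equation \<open>n R(g) = R(g') n\<close>, evaluated at vertices. In this form it can be restricted to a set
  of vertices that is invariant under \<open>n\<close>.
\<close>

lemma (in group) normalizer_right_regular_iff:
  assumes fin: "finite (carrier G)"
  shows "n \<in> normalizer (BijGroup (copies m G)) (right_regular m G) \<longleftrightarrow>
    n \<in> Bij (copies m G) \<and>
    (\<forall>g\<in>carrier G. \<exists>g'\<in>carrier G. \<forall>u\<in>copies m G.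
       n (fst u \<otimes> g, snd u) = (fst (n u) \<otimes> g', snd (n u)))"
proof -
  let ?V = "copies m G" and ?R = "right_mult m G"
  have sub: "right_regular m G \<subseteq> carrier (BijGroup ?V)"
    by (rule right_regular_subset) (rule group_axioms)
  then have R: "?R g \<in> Bij ?V" if "g \<in> carrier G" for g
    using that by (auto simp: right_regular_def BijGroup_def)
  have mult: "n \<otimes>\<^bsub>BijGroup ?V\<^esub> ?R g = ?R g' \<otimes>\<^bsub>BijGroup ?V\<^esub> n \<longleftrightarrow>
      (\<forall>u\<in>?V. n (fst u \<otimes> g, snd u) = (fst (n u) \<otimes> g', snd (n u)))"
    if "n \<in> Bij ?V" "g \<in> carrier G" "g' \<in> carrier G" for g g'
  proof -
    have "n u \<in> ?V" if "u \<in> ?V" for u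
      using \<open>n \<in> Bij ?V\<close> that by (auto dest: Bij_imp_funcset)
    then have "compose ?V n (?R g) u = compose ?V (?R g') n u \<longleftrightarrow>
        n (fst u \<otimes> g, snd u) = (fst (n u) \<otimes> g', snd (n u))" if "u \<in> ?V" for u
      using that by (simp add: compose_def right_mult_eq)
    moreover have "compose ?V n (?R g) = compose ?V (?R g') n \<longleftrightarrow>
        (\<forall>u\<in>?V. compose ?V n (?R g) u = compose ?V (?R g') n u)"
      by (auto intro: extensionalityI[of _ ?V] simp: compose_extensional)
    ultimately show ?thesis
      using that by (simp add: BijGroup_def R)
  qed
  have "finite (right_regular m G)"
    using fin by (simp add: right_regular_def)
  then have "n \<in> normalizer (BijGroup ?V) (right_regular m G) \<longleftrightarrow> n \<in> Bij ?V \<and>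
      (\<forall>g\<in>carrier G. \<exists>g'\<in>carrier G. n \<otimes>\<^bsub>BijGroup ?V\<^esub> ?R g = ?R g' \<otimes>\<^bsub>BijGroup ?V\<^esub> n)"
    using group.normalizer_iff[OF group_BijGroup sub]
    by (simp add: right_regular_def) (simp add: BijGroup_def)
  then show ?thesis
    using mult by (metis (no_types, lifting))
qed

text \<open>
  Both directions are included, so that adjacency in the multipartite complement, which refers to
  vertices in distinct parts, can be transported in either direction.
\<close>

definition preserves_parts :: "('a \<times> nat \<Rightarrow> 'b \<times> nat) \<Rightarrow> ('a \<times> nat) set \<Rightarrow> bool" where
  "preserves_parts f V \<longleftrightarrow> (\<forall>u\<in>V. \<forall>v\<in>V. snd (f u) = snd (f v) \<longleftrightarrow> snd u = snd v)"

text \<open>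
  The parts are the orbits of \<open>R(G)\<close>, and a normalizing permutation permutes orbits. On part indices
  it induces a surjection of a finite set, hence distinct parts stay distinct.
\<close>

lemma (in group) normalizer_preserves_parts:
  assumes fin: "finite (carrier G)"
    and n: "n \<in> normalizer (BijGroup (copies m G)) (right_regular m G)"
  shows "preserves_parts n (copies m G)"
proof -
  let ?V = "copies m G"
  have bij: "bij_betw n ?V ?V"
    using n fin by (simp add: normalizer_right_regular_iff Bij_def)
  have same: "snd (n u) = snd (n v)" if u: "u \<in> ?V" and v: "v \<in> ?V" and eq: "snd u = snd v" for u v
  proof -
    \<comment> \<open>\<open>R(g)\<close> moves \<open>u\<close> to \<open>v\<close>.\<close>
    let ?g = "inv (fst u) \<otimes> fst v"
    have "?g \<in> carrier G" and "v = (fst u \<otimes> ?g, snd u)"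
      using u v eq by (auto simp: mem_copies_iff m_assoc[symmetric] prod_eq_iff)
    with n fin u show ?thesis
      by (metis normalizer_right_regular_iff snd_conv)
  qed
  define \<sigma> where "\<sigma> i = snd (n (\<one>, i))" for i
  have \<sigma>: "snd (n u) = \<sigma> (snd u)" if "u \<in> ?V" for u
    unfolding \<sigma>_def using that by (intro same) (auto simp: mem_copies_iff)
  have "{1..m} \<subseteq> \<sigma> ` {1..m}"
  proof
    fix j assume "j \<in> {1..m}"
    then have "(\<one>, j) \<in> n ` ?V"
      using bij by (simp add: bij_betw_def mem_copies_iff)
    then obtain u where u: "u \<in> ?V" "n u = (\<one>, j)" by force
    then have "\<sigma> (snd u) = j" using \<sigma>[of u] by simp
    with u show "j \<in> \<sigma> ` {1..m}" by (force simp: mem_copies_iff)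
  qed
  then have "inj_on \<sigma> {1..m}"
    by (metis card_image_le eq_card_imp_inj_on finite_atLeastAtMost card_mono finite_imageI le_antisym)
  then show ?thesis
    using \<sigma> by (simp add: preserves_parts_def inj_on_eq_iff mem_copies_iff)
qed

section \<open>Arcs and isomorphisms of multipartite Cayley graphs\<close>

text \<open>
  In quotient form, adjacency no longer contains an existential quantifier over the connection set,
  and its invariance under right multiplication becomes visible.
\<close>

lemma (in group) arc_Cay_iff:
  assumes "connection_family m G S"
  shows "(u, v) \<in> parcs (Cay m G S) \<longleftrightarrow>
    u \<in> copies m G \<and> v \<in> copies m G \<and> fst v \<otimes> inv (fst u) \<in> S (snd u) (snd v)"
proof
  assume "(u, v) \<in> parcs (Cay m G S)"
  then obtain x i s j where "i \<in> {1..m}" "j \<in> {1..m}" "s \<in> S i j" "x \<in> carrier G"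
    "u = (x, i)" "v = (s \<otimes> x, j)"
    by (auto simp: Cay_def)
  moreover from this have "s \<in> carrier G"
    using assms unfolding connection_family_def by blast
  ultimately show "u \<in> copies m G \<and> v \<in> copies m G \<and> fst v \<otimes> inv (fst u) \<in> S (snd u) (snd v)"
    by (simp add: mem_copies_iff m_assoc)
next
  assume *: "u \<in> copies m G \<and> v \<in> copies m G \<and> fst v \<otimes> inv (fst u) \<in> S (snd u) (snd v)"
  then have "u = (fst u, snd u)" "v = (fst v \<otimes> inv (fst u) \<otimes> fst u, snd v)"
    by (auto simp: mem_copies_iff m_assoc prod_eq_iff)
  with * show "(u, v) \<in> parcs (Cay m G S)"
    unfolding Cay_def mem_copies_iff pair_pre_digraph.simps by blast
qed

lemma pverts_Cay [simp]: "pverts (Cay m G S) = copies m G"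
  by (simp add: Cay_def)

lemma (in group) arc_Cay_right_mult_iff:
  assumes S: "connection_family m G S" and g: "g \<in> carrier G"
    and uv: "u \<in> copies m G" "v \<in> copies m G"
  shows "((fst u \<otimes> g, snd u), (fst v \<otimes> g, snd v)) \<in> parcs (Cay m G S) \<longleftrightarrow>
    (u, v) \<in> parcs (Cay m G S)"
proof -
  have "fst v \<otimes> g \<otimes> inv (fst u \<otimes> g) = fst v \<otimes> inv (fst u)"
    using uv g by (simp add: mem_copies_iff inv_mult_group m_assoc[symmetric])
      (simp add: m_assoc)
  then show ?thesis
    using uv g by (simp add: arc_Cay_iff[OF S] mem_copies_iff)
qed

lemma (in group) arc_Cay_sym:
  assumes S: "connection_family m G S" and arc: "(u, v) \<in> parcs (Cay m G S)"
  shows "(v, u) \<in> parcs (Cay m G S)"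
proof -
  have *: "u \<in> copies m G" "v \<in> copies m G" "fst v \<otimes> inv (fst u) \<in> S (snd u) (snd v)"
    using arc by (auto simp: arc_Cay_iff[OF S])
  then have "inv (fst v \<otimes> inv (fst u)) \<in> S (snd v) (snd u)"
    using S unfolding connection_family_def mem_copies_iff by blast
  with * show ?thesis
    by (simp add: arc_Cay_iff[OF S] inv_mult_group mem_copies_iff)
qed

lemma (in group) arc_Cay_distinct_parts:
  assumes S: "connection_family m G S" and arc: "(u, v) \<in> parcs (Cay m G S)"
  shows "snd u \<noteq> snd v"
proof
  assume eq: "snd u = snd v"
  have u: "snd u \<in> {1..m}" and "S (snd u) (snd v) \<noteq> {}"
    using arc by (auto simp: arc_Cay_iff[OF S] mem_copies_iff)
  moreover have "S (snd u) (snd u) = {}"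
    using S u unfolding connection_family_def by simp
  ultimately show False
    using eq by simp
qed

lemma image_graph_eq_iff_isomorphism:
  assumes "bij_betw n (pverts \<Gamma>) (pverts \<Sigma>)"
    and \<Gamma>: "parcs \<Gamma> \<subseteq> pverts \<Gamma> \<times> pverts \<Gamma>" and \<Sigma>: "parcs \<Sigma> \<subseteq> pverts \<Sigma> \<times> pverts \<Sigma>"
  shows "image_graph n \<Gamma> = \<Sigma> \<longleftrightarrow> graph_isomorphism n \<Gamma> \<Sigma>"
proof -
  have inj: "inj_on n (pverts \<Gamma>)" and img: "n ` pverts \<Gamma> = pverts \<Sigma>"
    using assms by (auto simp: bij_betw_def)
  have "image_graph n \<Gamma> = \<Sigma> \<longleftrightarrow> {(n u, n v) | u v. (u, v) \<in> parcs \<Gamma>} = parcs \<Sigma>"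
    by (cases \<Sigma>) (use img in \<open>auto simp: image_graph_def\<close>)
  also have "\<dots> \<longleftrightarrow> (\<forall>u\<in>pverts \<Gamma>. \<forall>v\<in>pverts \<Gamma>. (u, v) \<in> parcs \<Gamma> \<longleftrightarrow> (n u, n v) \<in> parcs \<Sigma>)"
    (is "?L = _ \<longleftrightarrow> ?R")
  proof
    assume eq: "?L = parcs \<Sigma>"
    show ?R
    proof (intro ballI iffI)
      fix u v assume uv: "u \<in> pverts \<Gamma>" "v \<in> pverts \<Gamma>"
      { assume "(u, v) \<in> parcs \<Gamma>"
        with eq show "(n u, n v) \<in> parcs \<Sigma>" by blast }
      { assume "(n u, n v) \<in> parcs \<Sigma>"
        with eq obtain u' v' where "(u', v') \<in> parcs \<Gamma>" "n u = n u'" "n v = n v'" by blast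
        with \<Gamma> uv inj show "(u, v) \<in> parcs \<Gamma>" by (auto dest: inj_onD) }
    qed
  next
    assume R: ?R
    have "parcs \<Sigma> \<subseteq> ?L"
    proof
      fix a assume a: "a \<in> parcs \<Sigma>"
      with \<Sigma> img obtain u v where "u \<in> pverts \<Gamma>" "v \<in> pverts \<Gamma>" "a = (n u, n v)"
        by blast
      with R a show "a \<in> ?L" by blast
    qed
    with R \<Gamma> show "?L = parcs \<Sigma>" by blast
  qed
  finally show ?thesis
    using assms by (simp add: graph_isomorphism_def)
qed

lemma (in group) Cay_image_eq_iff:
  assumes S: "connection_family m G S" and T: "connection_family m G T"
    and n: "bij_betw n (copies m G) (copies m G)"
  shows "image_graph n (Cay m G S) = Cay m G T \<longleftrightarrow> graph_isomorphism n (Cay m G S) (Cay m G T)"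
  by (rule image_graph_eq_iff_isomorphism) (simp_all add: n, auto simp: arc_Cay_iff[OF S] arc_Cay_iff[OF T])

text \<open>
  Two parts with the same image would coincide, because the map is injective on vertices.
\<close>

lemma part_map_preserves_parts:
  assumes f: "bij_betw f (copies m G) (copies m G)"
    and parts: "\<forall>i\<in>{1..m}. \<exists>j\<in>{1..m}. f ` copy G i = copy G j"
  shows "preserves_parts f (copies m G)"
proof -
  have part: "u \<in> copy G i \<longleftrightarrow> fst u \<in> carrier G \<and> snd u = i" for u :: "'a \<times> nat" and i
    by (cases u) (auto simp: copy_def)
  have "snd (f u) = snd (f v) \<longleftrightarrow> snd u = snd v"
    if u: "u \<in> copies m G" and v: "v \<in> copies m G" for u v
  proof
    assume eq: "snd u = snd v"
    obtain j where "f ` copy G (snd u) = copy G j"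
      using parts u by (meson mem_copies_iff)
    with u v eq show "snd (f u) = snd (f v)"
      using part by (metis image_eqI mem_copies_iff)
  next
    assume eq: "snd (f u) = snd (f v)"
    obtain j k where jk: "f ` copy G (snd u) = copy G j" "f ` copy G (snd v) = copy G k"
      using parts u v by (meson mem_copies_iff)
    then have "f u \<in> copy G j" "f v \<in> copy G k"
      using u v part by (metis image_eqI mem_copies_iff)+
    with eq have "f u \<in> f ` copy G (snd v)"
      using jk part by metis
    then obtain w where w: "w \<in> copy G (snd v)" "f u = f w" by blast
    then have "w \<in> copies m G"
      using v by (auto simp: part mem_copies_iff)
    with w u f have "u = w"
      by (auto simp: bij_betw_def dest: inj_onD)
    with w show "snd u = snd v" by (simp add: part)
  qed
  then show ?thesis by (simp add: preserves_parts_def)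
qed

section \<open>Connectedness and multipartite complements\<close>

text \<open>
  Connectedness of a symmetric graph, phrased by cuts. With this form no paths have to be
  built: to show that a vertex set is everything, it suffices that no arc leaves it.
\<close>

definition cut_connected :: "'v pair_pre_digraph \<Rightarrow> bool" where
  "cut_connected \<Gamma> \<longleftrightarrow>
    (\<forall>A. A \<subseteq> pverts \<Gamma> \<and> A \<noteq> {} \<and> A \<noteq> pverts \<Gamma> \<longrightarrow> (\<exists>u v. (u, v) \<in> parcs \<Gamma> \<and> u \<in> A \<and> v \<notin> A))"

text \<open>
  The connection family of the multipartite complement.
\<close>

definition co_connection :: "('a, 'b) monoid_scheme \<Rightarrow> (nat \<Rightarrow> nat \<Rightarrow> 'a set) \<Rightarrow> nat \<Rightarrow> nat \<Rightarrow> 'a set" where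
  "co_connection G S i j = (if i = j then {} else carrier G - S i j)"

lemma (in group) connection_family_co_connection:
  assumes S: "connection_family m G S"
  shows "connection_family m G (co_connection G S)"
proof -
  have compl: "carrier G - S i j = (\<lambda>s. inv s) ` (carrier G - S j i)"
    if ij: "i \<in> {1..m}" "j \<in> {1..m}" for i j
  proof -
    have S_eq: "S i j = (\<lambda>s. inv s) ` S j i" and "S j i \<subseteq> carrier G"
      using S ij unfolding connection_family_def by blast+
    moreover have "bij_betw (\<lambda>s. inv s) (carrier G) (carrier G)"
      by (rule bij_betwI[where g = "\<lambda>s. inv s"]) auto
    ultimately have "(\<lambda>s. inv s) ` (carrier G - S j i) = carrier G - (\<lambda>s. inv s) ` S j i"
      using inj_on_image_set_diff[of "\<lambda>s. inv s" "carrier G" "carrier G" "S j i"]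
      by (simp only: bij_betw_def Diff_subset)
    with S_eq show ?thesis by simp
  qed
  show ?thesis
    unfolding connection_family_def
  proof (intro conjI ballI)
    fix i j assume ij: "i \<in> {1..m}" "j \<in> {1..m}"
    show "co_connection G S i j \<subseteq> carrier G"
      by (simp add: co_connection_def)
    show "co_connection G S i j = (\<lambda>s. inv s) ` co_connection G S j i"
      using compl[OF ij] by (cases "i = j") (simp_all add: co_connection_def)
  qed (simp add: co_connection_def)
qed

lemma (in group) arc_co_connection_iff:
  assumes S: "connection_family m G S"
  shows "(u, v) \<in> parcs (Cay m G (co_connection G S)) \<longleftrightarrow>
    u \<in> copies m G \<and> v \<in> copies m G \<and> snd u \<noteq> snd v \<and> (u, v) \<notin> parcs (Cay m G S)"
  unfolding arc_Cay_iff[OF S] arc_Cay_iff[OF connection_family_co_connection[OF S]]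
  by (cases "snd u = snd v") (simp_all add: co_connection_def mem_copies_iff cong: conj_cong)

lemma (in group) isomorphism_co_connection_iff:
  assumes S: "connection_family m G S" and T: "connection_family m G T"
    and bij: "bij_betw f (copies m G) (copies m G)" and f: "preserves_parts f (copies m G)"
  shows "graph_isomorphism f (Cay m G (co_connection G S)) (Cay m G (co_connection G T)) \<longleftrightarrow>
    graph_isomorphism f (Cay m G S) (Cay m G T)"
proof -
  have "((u, v) \<in> parcs (Cay m G (co_connection G S)) \<longleftrightarrow>
      (f u, f v) \<in> parcs (Cay m G (co_connection G T))) \<longleftrightarrow>
      ((u, v) \<in> parcs (Cay m G S) \<longleftrightarrow> (f u, f v) \<in> parcs (Cay m G T))"
    if "u \<in> copies m G" "v \<in> copies m G" for u v
  proof -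
    have "f u \<in> copies m G" "f v \<in> copies m G" "snd (f u) = snd (f v) \<longleftrightarrow> snd u = snd v"
      using that f bij_betw_apply[OF bij] by (simp_all add: preserves_parts_def)
    then show ?thesis
      using that arc_Cay_distinct_parts[OF S, of u v] arc_Cay_distinct_parts[OF T, of "f u" "f v"]
      unfolding arc_co_connection_iff[OF S] arc_co_connection_iff[OF T] by blast
  qed
  then show ?thesis
    using bij by (simp add: graph_isomorphism_def)
qed

text \<open>
  An isomorphism between two graphs is also one between their complements, which yields a normalizing
  permutation for the complements; the same permutation serves for the graphs themselves.
\<close>

lemma (in group) mPCI_graph_of_co_connection:
  assumes fin: "finite (carrier G)" and S: "connection_family m G S"
    and co: "mPCI_graph m G (Cay m G (co_connection G S))"
  shows "mPCI_graph m G (Cay m G S)"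
  unfolding mPCI_graph_def
proof (intro allI impI, elim conjE exE)
  fix \<Sigma> f
  assume "mPCayley_graph m G \<Sigma>" and iso: "graph_isomorphism f (Cay m G S) \<Sigma>"
    and parts: "\<forall>i\<in>{1..m}. \<exists>j\<in>{1..m}. f ` copy G i = copy G j"
  then obtain T where T: "connection_family m G T" and \<Sigma>: "\<Sigma> = Cay m G T"
    by (auto simp: mPCayley_graph_def)
  have coS: "connection_family m G (co_connection G S)"
    and coT: "connection_family m G (co_connection G T)"
    using S T by (simp_all add: connection_family_co_connection)
  have f: "bij_betw f (copies m G) (copies m G)"
    using iso by (simp add: \<Sigma> graph_isomorphism_def)
  then have "graph_isomorphism f (Cay m G (co_connection G S)) (Cay m G (co_connection G T))"
    using isomorphism_co_connection_iff[OF S T f] part_map_preserves_parts[OF f parts] iso \<Sigma>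
    by simp
  then obtain n where n: "n \<in> normalizer (BijGroup (copies m G)) (right_regular m G)"
    and img: "image_graph n (Cay m G (co_connection G S)) = Cay m G (co_connection G T)"
    using co parts coT unfolding mPCI_graph_def mPCayley_graph_def by blast
  have bij: "bij_betw n (copies m G) (copies m G)"
    using n fin by (simp add: normalizer_right_regular_iff Bij_def)
  have "image_graph n (Cay m G S) = Cay m G T"
    using img isomorphism_co_connection_iff[OF S T bij normalizer_preserves_parts[OF fin n]]
    by (simp add: Cay_image_eq_iff[OF coS coT bij] Cay_image_eq_iff[OF S T bij])
  with n \<Sigma> show "\<exists>n\<in>normalizer (BijGroup (copies m G)) (right_regular m G).
      image_graph n (Cay m G S) = \<Sigma>"
    by blast
qed

lemma not_cut_connectedE:
  assumes "\<not> cut_connected \<lparr>pverts = V, parcs = E\<rparr>"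
  obtains A where "A \<subseteq> V" "A \<noteq> {}" "A \<noteq> V" "\<forall>u. u \<in> A \<longrightarrow> (\<forall>v. (u, v) \<in> E \<longrightarrow> v \<in> A)"
proof -
  have "\<exists>A\<subseteq>V. A \<noteq> {} \<and> A \<noteq> V \<and> (\<forall>u. u \<in> A \<longrightarrow> (\<forall>v. (u, v) \<in> E \<longrightarrow> v \<in> A))"
  proof (rule ccontr)
    assume "\<not> ?thesis"
    with assms show False
      by (simp add: cut_connected_def)
  qed
  then show thesis
    by (elim exE conjE) (rule that)
qed

text \<open>
  Suppose that both graphs are disconnected, let \<open>A\<close> be closed under \<open>E\<close> with complement \<open>B\<close>, and
  let \<open>C\<close> be closed under \<open>E'\<close>. Vertices \<open>a \<in> A\<close> and \<open>b \<in> B\<close> of distinct parts are never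
  \<open>E\<close>-adjacent, hence \<open>E'\<close>-adjacent, so they lie on the same side of \<open>C\<close>. Since \<open>A\<close> and \<open>B\<close> each
  meet two parts and there is a third part, such pairs link all vertices, and \<open>C\<close> is everything.

  The assumption \<open>homogeneous\<close> says that the whole part of an isolated vertex is isolated. It
  excludes the one obstruction to the argument, a set \<open>A\<close> or \<open>B\<close> lying inside a single part. For Cayley
  graphs it holds because \<open>G\<close> acts transitively on each part.
\<close>

lemma multipartite_or_complement_cut_connected:
  fixes part :: "'v \<Rightarrow> 'p"
  assumes three: "\<And>i j. \<exists>w\<in>V. part w \<noteq> i \<and> part w \<noteq> j"
    and homogeneous: "\<And>u u'. u \<in> V \<Longrightarrow> u' \<in> V \<Longrightarrow> part u = part u' \<Longrightarrow>
      (\<forall>v. (u, v) \<notin> E) \<Longrightarrow> (\<forall>v. (u', v) \<notin> E)"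
    and sub: "E \<subseteq> V \<times> V" and sym: "\<And>u v. (u, v) \<in> E \<Longrightarrow> (v, u) \<in> E"
    and parts: "\<And>u v. (u, v) \<in> E \<Longrightarrow> part u \<noteq> part v"
    and co: "\<And>u v. (u, v) \<in> E' \<longleftrightarrow> u \<in> V \<and> v \<in> V \<and> part u \<noteq> part v \<and> (u, v) \<notin> E"
  shows "cut_connected \<lparr>pverts = V, parcs = E\<rparr> \<or> cut_connected \<lparr>pverts = V, parcs = E'\<rparr>"
proof (rule disjCI)
  assume "\<not> cut_connected \<lparr>pverts = V, parcs = E'\<rparr>"
  then obtain C where C: "C \<subseteq> V" "C \<noteq> {}" "C \<noteq> V"
    and closed: "\<forall>u. u \<in> C \<longrightarrow> (\<forall>v. (u, v) \<in> E' \<longrightarrow> v \<in> C)"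
    by (rule not_cut_connectedE)
  then have C_closed: "v \<in> C" if "(u, v) \<in> E'" "u \<in> C" for u v
    using that by simp
  have E'_iff: "u \<in> C \<longleftrightarrow> v \<in> C" if "(u, v) \<in> E'" for u v
  proof -
    have "(v, u) \<in> E'"
      using that sym[of v u] unfolding co by metis
    with that show ?thesis
      using C_closed[of u v] C_closed[of v u] by iprover
  qed
  show "cut_connected \<lparr>pverts = V, parcs = E\<rparr>"
  proof (rule ccontr)
    assume "\<not> cut_connected \<lparr>pverts = V, parcs = E\<rparr>"
    then obtain A where A: "A \<subseteq> V" "A \<noteq> {}" "A \<noteq> V"
      and closed: "\<forall>u. u \<in> A \<longrightarrow> (\<forall>v. (u, v) \<in> E \<longrightarrow> v \<in> A)"
      by (rule not_cut_connectedE)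
    then have A_closed: "v \<in> A" if "(u, v) \<in> E" "u \<in> A" for u v
      using that by simp
    define B where "B = V - A"
    \<comment> \<open>A wholly isolated part is joined to everything else in the complement, which is then connected.\<close>
    have not_isolated: "\<exists>v. (u, v) \<in> E" if u: "u \<in> V" for u
    proof (rule ccontr)
      assume "\<nexists>v. (u, v) \<in> E"
      then have co_adjacent: "(u', v) \<in> E'" if "u' \<in> V" "v \<in> V" "part u' = part u" "part v \<noteq> part u" for u' v
        using homogeneous[OF u, of u'] that by (auto simp: co)
      have outer: "u' \<in> C \<longleftrightarrow> v \<in> C"
        if "u' \<in> V" "v \<in> V" "part u' = part u" "part v \<noteq> part u" for u' v
        by (rule E'_iff[OF co_adjacent[OF that]])
      obtain w where w: "w \<in> V" "part w \<noteq> part u"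
        using three[of "part u" "part u"] by blast
      have "v \<in> C \<longleftrightarrow> u \<in> C" if "v \<in> V" for v
        using outer[of u v] outer[of v w] outer[of u w] u w that by metis
      with C show False by blast
    qed
    have many: "\<exists>v\<in>X. part v \<noteq> i" if X: "X = A \<or> X = B" for X i
    proof -
      obtain u where u: "u \<in> X" "u \<in> V"
        using X A B_def by blast
      then obtain v where v: "(u, v) \<in> E"
        using not_isolated by blast
      then have "v \<in> X"
        using X u A_closed[of u v] A_closed[of v u] sym[of u v] sub by (auto simp: B_def)
      with u v parts[of u v] show ?thesis by metis
    qed
    have cross: "a \<in> C \<longleftrightarrow> b \<in> C" if "a \<in> A" "b \<in> B" "part a \<noteq> part b" for a b
    proof (rule E'_iff)
      have "(a, b) \<notin> E"
        using that A_closed[of a b] by (auto simp: B_def)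
      with that A show "(a, b) \<in> E'"
        by (auto simp: co B_def)
    qed
    have same: "a \<in> C \<longleftrightarrow> a' \<in> C" if a: "a \<in> A" "a' \<in> A" for a a'
    proof (cases "\<exists>b\<in>B. part b \<noteq> part a \<and> part b \<noteq> part a'")
      case True
      then obtain b where "b \<in> B" "part a \<noteq> part b" "part a' \<noteq> part b"
        by metis
      then show ?thesis using cross[of a b] cross[of a' b] a by simp
    next
      case False
      obtain w where w: "w \<in> V" "part w \<noteq> part a" "part w \<noteq> part a'"
        using three[of "part a" "part a'"] by blast
      with False have wA: "w \<in> A"
        by (auto simp: B_def)
      \<comment> \<open>\<open>B\<close> meets only the parts of \<open>a\<close> and \<open>a'\<close>, so the third part lies in \<open>A\<close> and serves as a
        bridge: the chain \<open>a, b, w, b', a'\<close> crosses between \<open>A\<close> and \<open>B\<close> at each step.\<close>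
      obtain b b' where b: "b \<in> B" "part b \<noteq> part a" and b': "b' \<in> B" "part b' \<noteq> part a'"
        using many[of B "part a"] many[of B "part a'"] by blast
      have "part b = part a'" "part b' = part a"
        using False b b' by metis+
      then have "part b \<noteq> part w" "part b' \<noteq> part w"
        using w by auto
      then have "a \<in> C \<longleftrightarrow> b \<in> C" "b \<in> C \<longleftrightarrow> w \<in> C" "w \<in> C \<longleftrightarrow> b' \<in> C" "b' \<in> C \<longleftrightarrow> a' \<in> C"
        using cross[of a b] cross[of w b] cross[of w b'] cross[of a' b'] a b b' wA by metis+
      then show ?thesis by blast
    qed
    obtain a where a: "a \<in> A" using A by blast
    have "v \<in> C \<longleftrightarrow> a \<in> C" if "v \<in> V" for v
    proof (cases "v \<in> A")
      case True
      then show ?thesis using same a by blast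
    next
      case False
      with that have v: "v \<in> B" by (simp add: B_def)
      obtain a' where a': "a' \<in> A" "part a' \<noteq> part v"
        using many[of A "part v"] by blast
      then show ?thesis using cross[OF a'(1) v] same[OF a a'(1)] by blast
    qed
    with C show False by blast
  qed
qed

lemma (in group) Cay_or_complement_cut_connected:
  assumes S: "connection_family m G S" and m: "m \<ge> 3"
  shows "cut_connected (Cay m G S) \<or> cut_connected (Cay m G (co_connection G S))"
proof -
  have Cay_eq: "\<lparr>pverts = copies m G, parcs = parcs (Cay m G U)\<rparr> = Cay m G U" for U
    by (simp add: Cay_def)
  have "cut_connected \<lparr>pverts = copies m G, parcs = parcs (Cay m G S)\<rparr> \<or>
      cut_connected \<lparr>pverts = copies m G, parcs = parcs (Cay m G (co_connection G S))\<rparr>"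
  proof (rule multipartite_or_complement_cut_connected[where part = snd])
    fix i j :: nat
    \<comment> \<open>Two indices cannot exhaust three parts.\<close>
    have "card {i, j} \<le> 2"
      by (simp add: card_insert_if)
    then have "\<not> {1..m} \<subseteq> {i, j}"
      using m card_mono[of "{i, j}" "{1..m}"] by auto
    then obtain k where "k \<in> {1..m}" "k \<noteq> i" "k \<noteq> j"
      by blast
    then show "\<exists>w\<in>copies m G. snd w \<noteq> i \<and> snd w \<noteq> j"
      by (intro bexI[of _ "(\<one>, k)"]) (auto simp: mem_copies_iff)
  next
    fix u u' :: "'a \<times> nat"
    assume u: "u \<in> copies m G" "u' \<in> copies m G" "snd u = snd u'"
      and isolated: "\<forall>v. (u, v) \<notin> parcs (Cay m G S)"
    show "\<forall>v. (u', v) \<notin> parcs (Cay m G S)"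
    proof
      fix v
      let ?g = "inv (fst u') \<otimes> fst u"
      have g: "?g \<in> carrier G" and "u = (fst u' \<otimes> ?g, snd u')"
        using u by (auto simp: mem_copies_iff m_assoc[symmetric] prod_eq_iff)
      then show "(u', v) \<notin> parcs (Cay m G S)"
        using isolated arc_Cay_right_mult_iff[OF S g, of u' v] u(2)
        by (auto simp: arc_Cay_iff[OF S])
    qed
  next
    show "parcs (Cay m G S) \<subseteq> copies m G \<times> copies m G"
      by (auto simp: arc_Cay_iff[OF S])
  qed (use arc_Cay_sym[OF S] arc_Cay_distinct_parts[OF S] arc_co_connection_iff[OF S] in blast)+
  then show ?thesis by (simp add: Cay_eq)
qed

section \<open>Extending from a subgroup to the group\<close>

definition coset_rep :: "('a, 'b) monoid_scheme \<Rightarrow> 'a set \<Rightarrow> 'a \<Rightarrow> 'a" where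
  "coset_rep G H x = (SOME y. y \<in> H #>\<^bsub>G\<^esub> x)"

text \<open>
  Applies \<open>f\<close> on every right coset of \<open>H\<close>, transported by the chosen representative: \<open>hr\<close> is sent to
  \<open>f(h)r\<close>. Right translations commute with the left multiplications that define arcs, so this respects
  the graph structure.
\<close>

definition coset_extension ::
    "('a, 'b) monoid_scheme \<Rightarrow> 'a set \<Rightarrow> ('a \<times> nat \<Rightarrow> 'a \<times> nat) \<Rightarrow> 'a \<times> nat \<Rightarrow> 'a \<times> nat" where
  "coset_extension G H f u =
    (let r = coset_rep G H (fst u); v = f (fst u \<otimes>\<^bsub>G\<^esub> inv\<^bsub>G\<^esub> r, snd u)
     in (fst v \<otimes>\<^bsub>G\<^esub> r, snd v))"

context
  fixes G :: "('a, 'b) monoid_scheme" and H and K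
  assumes G: "group G" and H: "subgroup H G"
  defines "K \<equiv> G\<lparr>carrier := H\<rparr>"
begin

interpretation G: group G by (rule G)
interpretation K: group K unfolding K_def by (rule G.subgroup_imp_group[OF H])

lemma sub_carrier: "h \<in> H \<Longrightarrow> h \<in> carrier G"
  using subgroup.subset[OF H] by blast

lemma K_simps: "carrier K = H" "x \<otimes>\<^bsub>K\<^esub> y = x \<otimes>\<^bsub>G\<^esub> y" "x \<in> H \<Longrightarrow> inv\<^bsub>K\<^esub> x = inv\<^bsub>G\<^esub> x"
  by (simp_all add: K_def G.m_inv_consistent[OF H])

lemma copies_K_subset: "copies m K \<subseteq> copies m G"
  by (auto simp: mem_copies_iff K_simps sub_carrier)

lemma connection_family_extend:
  assumes "connection_family m K S"
  shows "connection_family m G S"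
proof -
  have sub: "\<forall>i\<in>{1..m}. \<forall>j\<in>{1..m}. S i j \<subseteq> H" and diag: "\<forall>i\<in>{1..m}. S i i = {}"
    and inverse: "\<forall>i\<in>{1..m}. \<forall>j\<in>{1..m}. S i j = (\<lambda>s. inv\<^bsub>K\<^esub> s) ` S j i"
    using assms[unfolded connection_family_def K_simps(1)] by iprover+
  show ?thesis
    unfolding connection_family_def
  proof (intro conjI ballI)
    fix i j assume ij: "i \<in> {1..m}" "j \<in> {1..m}"
    show "S i j \<subseteq> carrier G"
      using sub ij subgroup.subset[OF H] by blast
    have "S j i \<subseteq> H"
      using sub ij by blast
    then have "(\<lambda>s. inv\<^bsub>K\<^esub> s) ` S j i = (\<lambda>s. inv\<^bsub>G\<^esub> s) ` S j i"
      by (intro image_cong) (auto simp: K_simps(3))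
    with inverse ij show "S i j = (\<lambda>s. inv\<^bsub>G\<^esub> s) ` S j i"
      by metis
  qed (use diag in blast)
qed

text \<open>
  The graph over \<open>H\<close> is a union of components of the graph over \<open>G\<close>: arcs are left
  multiplications by elements of \<open>H\<close>, so an arc that starts in \<open>H\<close> stays in \<open>H\<close>.
\<close>

lemma arc_extend_iff:
  assumes S: "connection_family m K S" and u: "u \<in> copies m K" and v: "v \<in> copies m G"
  shows "(u, v) \<in> parcs (Cay m G S) \<longleftrightarrow> (u, v) \<in> parcs (Cay m K S)"
proof -
  note SG = connection_family_extend[OF S]
  have "fst v \<in> H" if s: "fst v \<otimes>\<^bsub>G\<^esub> inv\<^bsub>G\<^esub> (fst u) \<in> S (snd u) (snd v)"
  proof -
    have "fst v \<otimes>\<^bsub>G\<^esub> inv\<^bsub>G\<^esub> (fst u) \<in> H"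
      using s S u v unfolding connection_family_def mem_copies_iff K_simps by blast
    then have "fst v \<otimes>\<^bsub>G\<^esub> inv\<^bsub>G\<^esub> (fst u) \<otimes>\<^bsub>G\<^esub> fst u \<in> H"
      using u subgroup.m_closed[OF H] by (simp add: mem_copies_iff K_simps)
    with u v show ?thesis
      by (simp add: mem_copies_iff K_simps sub_carrier G.m_assoc)
  qed
  with u v show ?thesis
    by (auto simp: G.arc_Cay_iff[OF SG] K.arc_Cay_iff[OF S] mem_copies_iff K_simps sub_carrier)
qed

lemma coset_rep:
  assumes x: "x \<in> carrier G"
  shows coset_rep_carrier: "coset_rep G H x \<in> carrier G"
    and coset_rep_quotient: "x \<otimes>\<^bsub>G\<^esub> inv\<^bsub>G\<^esub> (coset_rep G H x) \<in> H"
    and coset_rep_mult: "h \<in> H \<Longrightarrow> coset_rep G H (h \<otimes>\<^bsub>G\<^esub> x) = coset_rep G H x"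
proof -
  have "x \<in> H #>\<^bsub>G\<^esub> x"
    using x by (rule G.rcos_self[OF _ H])
  then have mem: "coset_rep G H x \<in> H #>\<^bsub>G\<^esub> x"
    unfolding coset_rep_def by (rule someI)
  then obtain h' where h': "h' \<in> H" "coset_rep G H x = h' \<otimes>\<^bsub>G\<^esub> x"
    by (auto simp: r_coset_def)
  then show "coset_rep G H x \<in> carrier G"
    using x by (simp add: sub_carrier)
  show "x \<otimes>\<^bsub>G\<^esub> inv\<^bsub>G\<^esub> (coset_rep G H x) \<in> H"
    using x h' subgroup.m_inv_closed[OF H]
    by (simp add: sub_carrier G.inv_mult_group G.m_assoc[symmetric])
  show "coset_rep G H (h \<otimes>\<^bsub>G\<^esub> x) = coset_rep G H x" if h: "h \<in> H"
  proof -
    have "h \<otimes>\<^bsub>G\<^esub> x \<in> H #>\<^bsub>G\<^esub> x"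
      using h by (auto simp: r_coset_def)
    then have "H #>\<^bsub>G\<^esub> x = H #>\<^bsub>G\<^esub> (h \<otimes>\<^bsub>G\<^esub> x)"
      by (rule G.repr_independence[OF _ x H])
    then show ?thesis by (simp add: coset_rep_def)
  qed
qed

text \<open>
  Canonical coordinates: every vertex is the translate by a coset representative of a vertex over \<open>H\<close>.
  The condition \<open>r = coset_rep G H r\<close> singles out the representatives and makes the coordinates
  unique (\<open>coset_mult_eq\<close>).
\<close>

lemma coset_decomposition:
  assumes "u \<in> copies m G"
  obtains w r where "w \<in> copies m K" "r \<in> carrier G" "r = coset_rep G H r"
    "u = (fst w \<otimes>\<^bsub>G\<^esub> r, snd w)"
proof -
  let ?r = "coset_rep G H (fst u)"
  let ?h = "fst u \<otimes>\<^bsub>G\<^esub> inv\<^bsub>G\<^esub> ?r"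
  have u: "fst u \<in> carrier G" using assms by (simp add: mem_copies_iff)
  note r = coset_rep_carrier[OF u] and h = coset_rep_quotient[OF u]
  have fst: "fst u = ?h \<otimes>\<^bsub>G\<^esub> ?r"
    using u r by (simp add: G.m_assoc)
  then have "?r = coset_rep G H ?r"
    using coset_rep_mult[OF r h] by simp
  moreover have "(?h, snd u) \<in> copies m K"
    using assms h by (simp add: mem_copies_iff K_simps)
  ultimately show thesis
    using that[of "(?h, snd u)" ?r] r fst by (metis fst_conv prod.collapse snd_conv)
qed

lemma coset_extension_eq:
  assumes "w \<in> copies m K" "r \<in> carrier G" "r = coset_rep G H r"
  shows "coset_extension G H f (fst w \<otimes>\<^bsub>G\<^esub> r, snd w) = (fst (f w) \<otimes>\<^bsub>G\<^esub> r, snd (f w))"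
proof -
  have w: "fst w \<in> H" using assms by (simp add: mem_copies_iff K_simps)
  then have "coset_rep G H (fst w \<otimes>\<^bsub>G\<^esub> r) = r"
    using coset_rep_mult[OF assms(2), of "fst w"] assms(3) by simp
  then show ?thesis
    using w assms by (simp add: coset_extension_def Let_def G.m_assoc sub_carrier)
qed

lemma coset_mult_eq:
  assumes eq: "h \<otimes>\<^bsub>G\<^esub> r = h' \<otimes>\<^bsub>G\<^esub> r'" and "h \<in> H" "h' \<in> H"
    and r: "r \<in> carrier G" "r = coset_rep G H r" and r': "r' \<in> carrier G" "r' = coset_rep G H r'"
  shows "r = r'" "h = h'"
proof -
  show "r = r'"
    using coset_rep_mult[of r h] coset_rep_mult[of r' h'] assms by metis
  with assms show "h = h'" by (simp add: sub_carrier)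
qed

text \<open>
  In canonical coordinates, arcs over \<open>G\<close> join only vertices with the same representative, and there
  they are the arcs over \<open>H\<close>; \<open>f\<close> acts on the \<open>H\<close>-coordinate alone.
\<close>

lemma coset_extension_isomorphism:
  assumes S: "connection_family m K S" and T: "connection_family m K T"
    and fin: "finite (carrier G)"
    and iso: "graph_isomorphism f (Cay m K S) (Cay m K T)"
  shows "graph_isomorphism (coset_extension G H f) (Cay m G S) (Cay m G T)"
proof -
  let ?F = "coset_extension G H f"
  note SG = connection_family_extend[OF S] and TG = connection_family_extend[OF T]
  have f: "bij_betw f (copies m K) (copies m K)"
    and f_arc: "\<And>u v. u \<in> copies m K \<Longrightarrow> v \<in> copies m K \<Longrightarrow>
      (u, v) \<in> parcs (Cay m K S) \<longleftrightarrow> (f u, f v) \<in> parcs (Cay m K T)"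
    using iso by (auto simp: graph_isomorphism_def)
  have fH: "f w \<in> copies m K" "fst (f w) \<in> H" if "w \<in> copies m K" for w
  proof -
    show "f w \<in> copies m K" using f that by (auto simp: bij_betw_def)
    then show "fst (f w) \<in> H" by (simp add: mem_copies_iff K_simps)
  qed
  have into: "?F u \<in> copies m G" if u: "u \<in> copies m G" for u
  proof -
    obtain w r where w: "w \<in> copies m K" "r \<in> carrier G" "r = coset_rep G H r"
      "u = (fst w \<otimes>\<^bsub>G\<^esub> r, snd w)"
      using coset_decomposition[OF u] .
    then show ?thesis
      using fH[OF w(1)] unfolding w(4) coset_extension_eq[OF w(1-3)]
      by (simp add: mem_copies_iff sub_carrier)
  qed
  have inj: "inj_on ?F (copies m G)"
  proof (rule inj_onI)
    fix u v assume u: "u \<in> copies m G" and v: "v \<in> copies m G" and eq: "?F u = ?F v"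
    obtain w r where w: "w \<in> copies m K" "r \<in> carrier G" "r = coset_rep G H r"
      "u = (fst w \<otimes>\<^bsub>G\<^esub> r, snd w)"
      using coset_decomposition[OF u] .
    obtain w' r' where w': "w' \<in> copies m K" "r' \<in> carrier G" "r' = coset_rep G H r'"
      "v = (fst w' \<otimes>\<^bsub>G\<^esub> r', snd w')"
      using coset_decomposition[OF v] .
    have eqs: "fst (f w) \<otimes>\<^bsub>G\<^esub> r = fst (f w') \<otimes>\<^bsub>G\<^esub> r'" "snd (f w) = snd (f w')"
      using eq unfolding w(4) w'(4) coset_extension_eq[OF w(1-3)] coset_extension_eq[OF w'(1-3)]
      by auto
    note r = coset_mult_eq[OF eqs(1) fH(2)[OF w(1)] fH(2)[OF w'(1)] w(2,3) w'(2,3)]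
    then have "f w = f w'" using eqs by (simp add: prod_eq_iff)
    with f w(1) w'(1) have "w = w'" by (auto simp: bij_betw_def dest: inj_onD)
    with r w w' show "u = v" by simp
  qed
  have bij: "bij_betw ?F (copies m G) (copies m G)"
    unfolding bij_betw_def using inj into endo_inj_surj[OF finite_copies[OF fin]] by blast
  have "(u, v) \<in> parcs (Cay m G S) \<longleftrightarrow> (?F u, ?F v) \<in> parcs (Cay m G T)"
    if u: "u \<in> copies m G" and v: "v \<in> copies m G" for u v
  proof -
    obtain w r where w: "w \<in> copies m K" "r \<in> carrier G" "r = coset_rep G H r"
      "u = (fst w \<otimes>\<^bsub>G\<^esub> r, snd w)"
      using coset_decomposition[OF u] .
    obtain w' r' where w': "w' \<in> copies m K" "r' \<in> carrier G" "r' = coset_rep G H r'"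
      "v = (fst w' \<otimes>\<^bsub>G\<^esub> r', snd w')"
      using coset_decomposition[OF v] .
    have arc: "((fst p \<otimes>\<^bsub>G\<^esub> r, snd p), (fst q \<otimes>\<^bsub>G\<^esub> r', snd q)) \<in> parcs (Cay m G U) \<longleftrightarrow>
        r = r' \<and> (p, q) \<in> parcs (Cay m K U)"
      if U: "connection_family m K U" and p: "p \<in> copies m K" and q: "q \<in> copies m K" for p q U
    proof (cases "r = r'")
      case True
      have pq: "p \<in> copies m G" "q \<in> copies m G"
        using p q copies_K_subset by auto
      then show ?thesis
        using True G.arc_Cay_right_mult_iff[OF connection_family_extend[OF U] w(2) pq]
          arc_extend_iff[OF U p pq(2)] by simp
    next
      case False
      have pH: "fst p \<in> H" "fst q \<in> H" "snd p \<in> {1..m}" "snd q \<in> {1..m}"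
        using p q by (simp_all add: mem_copies_iff K_simps)
      have "((fst p \<otimes>\<^bsub>G\<^esub> r, snd p), (fst q \<otimes>\<^bsub>G\<^esub> r', snd q)) \<notin> parcs (Cay m G U)"
      proof
        assume "((fst p \<otimes>\<^bsub>G\<^esub> r, snd p), (fst q \<otimes>\<^bsub>G\<^esub> r', snd q)) \<in> parcs (Cay m G U)"
        then have "fst q \<otimes>\<^bsub>G\<^esub> r' \<otimes>\<^bsub>G\<^esub> inv\<^bsub>G\<^esub> (fst p \<otimes>\<^bsub>G\<^esub> r) \<in> U (snd p) (snd q)" (is "?s \<in> _")
          by (simp add: G.arc_Cay_iff[OF connection_family_extend[OF U]])
        then have s: "?s \<in> H"
          using U pH unfolding connection_family_def K_simps by blast
        have "(?s \<otimes>\<^bsub>G\<^esub> fst p) \<otimes>\<^bsub>G\<^esub> r = fst q \<otimes>\<^bsub>G\<^esub> r'"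
          using pH w(2) w'(2) by (simp add: sub_carrier G.m_assoc)
        then have "r = r'"
          using coset_mult_eq(1) s pH w(2,3) w'(2,3) subgroup.m_closed[OF H] by metis
        with False show False ..
      qed
      with False show ?thesis by simp
    qed
    show ?thesis
      unfolding w(4) w'(4) coset_extension_eq[OF w(1-3)] coset_extension_eq[OF w'(1-3)]
      using arc[OF S w(1) w'(1)] arc[OF T fH(1)[OF w(1)] fH(1)[OF w'(1)]] f_arc[OF w(1) w'(1)]
      by simp
  qed
  with bij show ?thesis by (simp add: graph_isomorphism_def)
qed

lemma coset_extension_image_copy:
  assumes i: "i \<in> {1..m}" and eq: "f ` copy K i = copy K j"
  shows "coset_extension G H f ` copy G i = copy G j"
proof -
  let ?F = "coset_extension G H f"
  have mem: "p \<in> copy K k \<longleftrightarrow> fst p \<in> H \<and> snd p = k" "p \<in> copy G k \<longleftrightarrow> fst p \<in> carrier G \<and> snd p = k" for p k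
    by (cases p; auto simp: copy_def K_simps)+
  show ?thesis
  proof (intro equalityI subsetI)
    fix v assume "v \<in> ?F ` copy G i"
    then obtain u where u: "fst u \<in> carrier G" "snd u = i" "v = ?F u"
      by (auto simp: mem)
    then have "u \<in> copies m G" using i by (simp add: mem_copies_iff)
    then obtain w r where w: "w \<in> copies m K" "r \<in> carrier G" "r = coset_rep G H r"
      "u = (fst w \<otimes>\<^bsub>G\<^esub> r, snd w)"
      by (rule coset_decomposition)
    then have "w \<in> copy K i" using u by (simp add: mem mem_copies_iff K_simps)
    with eq have "f w \<in> copy K j" by blast
    then show "v \<in> copy G j"
      using u(3) w coset_extension_eq[OF w(1-3), of f] by (simp add: mem sub_carrier)
  next
    fix v assume v: "v \<in> copy G j"
    let ?r = "coset_rep G H (fst v)"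
    have v': "fst v \<in> carrier G" "snd v = j" using v by (auto simp: mem)
    note r = coset_rep_carrier[OF v'(1)] and h = coset_rep_quotient[OF v'(1)]
    have fst: "fst v = (fst v \<otimes>\<^bsub>G\<^esub> inv\<^bsub>G\<^esub> ?r) \<otimes>\<^bsub>G\<^esub> ?r"
      using v' r by (simp add: G.m_assoc)
    then have rr: "?r = coset_rep G H ?r"
      using coset_rep_mult[OF r h] by simp
    have "(fst v \<otimes>\<^bsub>G\<^esub> inv\<^bsub>G\<^esub> ?r, j) \<in> f ` copy K i"
      using eq h by (simp add: mem)
    then obtain w where w: "w \<in> copy K i" "f w = (fst v \<otimes>\<^bsub>G\<^esub> inv\<^bsub>G\<^esub> ?r, j)" by force
    then have wK: "w \<in> copies m K" using i by (simp add: mem mem_copies_iff K_simps)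
    have "?F (fst w \<otimes>\<^bsub>G\<^esub> ?r, snd w) = v"
      using coset_extension_eq[OF wK r rr, of f] w fst v' by (simp add: prod_eq_iff)
    moreover have "(fst w \<otimes>\<^bsub>G\<^esub> ?r, snd w) \<in> copy G i"
      using w r by (simp add: mem sub_carrier)
    ultimately show "v \<in> ?F ` copy G i" by (metis image_eqI)
  qed
qed

text \<open>
  The heart of the proof. Connectedness forces the normalizing permutation over \<open>G\<close>, once translated
  suitably, to preserve the copies of \<open>H\<close>, and its restriction then normalizes \<open>R(H)\<close>.
\<close>

lemma cut_connected_imp_mPCI_graph:
  assumes m: "m \<ge> 1" and fin: "finite (carrier G)" and PCI: "mPCI_group m G"
    and S: "connection_family m K S" and conn: "cut_connected (Cay m K S)"
  shows "mPCI_graph m K (Cay m K S)"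
  unfolding mPCI_graph_def
proof (intro allI impI, elim conjE exE)
  fix \<Sigma> f
  assume "mPCayley_graph m K \<Sigma>" and iso: "graph_isomorphism f (Cay m K S) \<Sigma>"
    and parts: "\<forall>i\<in>{1..m}. \<exists>j\<in>{1..m}. f ` copy K i = copy K j"
  then obtain T where T: "connection_family m K T" and \<Sigma>: "\<Sigma> = Cay m K T"
    by (auto simp: mPCayley_graph_def)
  note SG = connection_family_extend[OF S] and TG = connection_family_extend[OF T]
  have finK: "finite (carrier K)"
    using fin subgroup.subset[OF H] by (auto simp: K_simps intro: finite_subset)
  have "graph_isomorphism (coset_extension G H f) (Cay m G S) (Cay m G T)"
    using coset_extension_isomorphism[OF S T fin] iso \<Sigma> by simp
  moreover have "\<forall>i\<in>{1..m}. \<exists>j\<in>{1..m}. coset_extension G H f ` copy G i = copy G j"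
  proof
    fix i assume i: "i \<in> {1..m}"
    obtain j where "j \<in> {1..m}" "f ` copy K i = copy K j"
      using bspec[OF parts i] by (rule bexE)
    with i show "\<exists>j\<in>{1..m}. coset_extension G H f ` copy G i = copy G j"
      using coset_extension_image_copy by metis
  qed
  moreover have "mPCI_graph m G (Cay m G S)" and "mPCayley_graph m G (Cay m G T)"
    using PCI SG TG unfolding mPCI_group_def mPCayley_graph_def by blast+
  ultimately obtain n where n: "n \<in> normalizer (BijGroup (copies m G)) (right_regular m G)"
    and img: "image_graph n (Cay m G S) = Cay m G T"
    unfolding mPCI_graph_def by blast
  have bij: "bij_betw n (copies m G) (copies m G)"
    and n_mult: "\<And>g. g \<in> carrier G \<Longrightarrow> \<exists>g'\<in>carrier G. \<forall>u\<in>copies m G.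
      n (fst u \<otimes>\<^bsub>G\<^esub> g, snd u) = (fst (n u) \<otimes>\<^bsub>G\<^esub> g', snd (n u))"
    using n fin by (simp_all add: G.normalizer_right_regular_iff Bij_def)
  have n_in: "n u \<in> copies m G" if "u \<in> copies m G" for u
    using bij that by (auto simp: bij_betw_def)
  \<comment> \<open>Translating by \<open>R(x)\<close> inverse, where \<open>x\<close> is the group coordinate of \<open>n e\<close>, brings the image of
    the base vertex \<open>e\<close> back to a copy of the identity.\<close>
  define e where "e = (\<one>\<^bsub>G\<^esub>, 1::nat)"
  have fst_e: "fst e = \<one>\<^bsub>G\<^esub>"
    by (simp add: e_def)
  have e: "e \<in> copies m G" "e \<in> copies m K"
    using m subgroup.one_closed[OF H] by (simp_all add: e_def mem_copies_iff K_simps)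
  define x where "x = fst (n e)"
  have x: "x \<in> carrier G"
    using n_in[OF e(1)] by (simp add: x_def mem_copies_iff)
  define n\<^sub>1 where "n\<^sub>1 u = (fst (n u) \<otimes>\<^bsub>G\<^esub> inv\<^bsub>G\<^esub> x, snd (n u))" for u
  have n\<^sub>1_in: "n\<^sub>1 u \<in> copies m G" if "u \<in> copies m G" for u
    using n_in[OF that] x by (simp add: n\<^sub>1_def mem_copies_iff)
  have n\<^sub>1_inj: "u = v" if "u \<in> copies m G" "v \<in> copies m G" "n\<^sub>1 u = n\<^sub>1 v" for u v
  proof -
    have "n u = n v"
      using n_in[OF that(1)] n_in[OF that(2)] that(3) x
      by (simp add: n\<^sub>1_def mem_copies_iff prod_eq_iff)
    with bij that show ?thesis by (auto simp: bij_betw_def dest: inj_onD)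
  qed
  have n\<^sub>1_arc: "(u, v) \<in> parcs (Cay m G S) \<longleftrightarrow> (n\<^sub>1 u, n\<^sub>1 v) \<in> parcs (Cay m G T)"
    if "u \<in> copies m G" "v \<in> copies m G" for u v
    using img that n_in x G.arc_Cay_right_mult_iff[OF TG]
    by (simp add: G.Cay_image_eq_iff[OF SG TG bij] graph_isomorphism_def n\<^sub>1_def)
  have n\<^sub>1_e: "n\<^sub>1 e \<in> copies m K"
    using n_in[OF e(1)] x subgroup.one_closed[OF H]
    by (simp add: n\<^sub>1_def mem_copies_iff K_simps flip: x_def)
  \<comment> \<open>No arc leaves the set of vertices over \<open>H\<close> whose image is again over \<open>H\<close>.\<close>
  define A where "A = {u \<in> copies m K. n\<^sub>1 u \<in> copies m K}"
  have "A = pverts (Cay m K S)"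
  proof -
    have "v \<in> A" if arc: "(u, v) \<in> parcs (Cay m K S)" and u: "u \<in> A" for u v
    proof -
      have uv: "u \<in> copies m K" "v \<in> copies m K" "u \<in> copies m G" "v \<in> copies m G"
        using arc copies_K_subset by (auto simp: K.arc_Cay_iff[OF S])
      have "(n\<^sub>1 u, n\<^sub>1 v) \<in> parcs (Cay m G T)"
        using arc arc_extend_iff[OF S uv(1,4)] n\<^sub>1_arc[OF uv(3,4)] by simp
      then have "(n\<^sub>1 u, n\<^sub>1 v) \<in> parcs (Cay m K T)"
        using arc_extend_iff[OF T _ n\<^sub>1_in[OF uv(4)], of "n\<^sub>1 u"] u by (simp add: A_def)
      then have "n\<^sub>1 v \<in> copies m K"
        by (simp add: K.arc_Cay_iff[OF T])
      with uv show ?thesis by (simp add: A_def)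
    qed
    moreover have "A \<noteq> {}" "A \<subseteq> copies m K"
      using e(2) n\<^sub>1_e unfolding A_def by blast+
    ultimately show ?thesis
      using conn unfolding cut_connected_def pverts_Cay by metis
  qed
  then have n\<^sub>1_K: "n\<^sub>1 u \<in> copies m K" if "u \<in> copies m K" for u
    using that by (auto simp: A_def)
  define n' where "n' = restrict n\<^sub>1 (copies m K)"
  have n'_eq: "n' u = n\<^sub>1 u" if "u \<in> copies m K" for u
    using that by (simp add: n'_def)
  have "inj_on n' (copies m K)"
    by (rule inj_onI) (metis n\<^sub>1_inj n'_eq subsetD[OF copies_K_subset])
  moreover have "n' ` copies m K \<subseteq> copies m K"
    using n\<^sub>1_K n'_eq by auto
  ultimately have bij': "bij_betw n' (copies m K) (copies m K)"
    unfolding bij_betw_def using endo_inj_surj[OF finite_copies[OF finK]] by blast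
  have "\<exists>g'\<in>carrier K. \<forall>u\<in>copies m K.
      n' (fst u \<otimes>\<^bsub>K\<^esub> g, snd u) = (fst (n' u) \<otimes>\<^bsub>K\<^esub> g', snd (n' u))" if g: "g \<in> carrier K" for g
  proof -
    have gH: "g \<in> H" and gG: "g \<in> carrier G"
      using g by (auto simp: K_simps sub_carrier)
    obtain g' where g': "g' \<in> carrier G" and ng: "\<And>u. u \<in> copies m G \<Longrightarrow>
        n (fst u \<otimes>\<^bsub>G\<^esub> g, snd u) = (fst (n u) \<otimes>\<^bsub>G\<^esub> g', snd (n u))"
      using n_mult[OF gG] by blast
    \<comment> \<open>\<open>n\<close> conjugates \<open>R(g)\<close> to \<open>R(g')\<close>; the additional translation conjugates this to \<open>R(h)\<close>.\<close>
    define h where "h = x \<otimes>\<^bsub>G\<^esub> g' \<otimes>\<^bsub>G\<^esub> inv\<^bsub>G\<^esub> x"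
    have hG: "h \<in> carrier G" using x g' by (simp add: h_def)
    have n\<^sub>1g: "n\<^sub>1 (fst u \<otimes>\<^bsub>G\<^esub> g, snd u) = (fst (n\<^sub>1 u) \<otimes>\<^bsub>G\<^esub> h, snd (n\<^sub>1 u))"
      if u: "u \<in> copies m G" for u
    proof -
      have "fst (n u) \<in> carrier G" using n_in[OF u] by (simp add: mem_copies_iff)
      moreover from this have "inv\<^bsub>G\<^esub> x \<otimes>\<^bsub>G\<^esub> (x \<otimes>\<^bsub>G\<^esub> (g' \<otimes>\<^bsub>G\<^esub> inv\<^bsub>G\<^esub> x)) = g' \<otimes>\<^bsub>G\<^esub> inv\<^bsub>G\<^esub> x"
        using x g' by (simp flip: G.m_assoc)
      ultimately show ?thesis
        using x g' by (simp add: n\<^sub>1_def ng[OF u] h_def G.m_assoc)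
    qed
    have closed: "(fst u \<otimes>\<^bsub>G\<^esub> g, snd u) \<in> copies m K" if "u \<in> copies m K" for u
      using that gH subgroup.m_closed[OF H] by (simp add: mem_copies_iff K_simps)
    \<comment> \<open>At the base vertex the group coordinate of the image is \<open>h\<close> itself, and the image is over \<open>H\<close>.\<close>
    have "n\<^sub>1 (fst e \<otimes>\<^bsub>G\<^esub> g, snd e) = (h, snd (n\<^sub>1 e))"
      using n\<^sub>1g[OF e(1)] x hG by (simp add: n\<^sub>1_def flip: x_def)
    then have "h \<in> H"
      using n\<^sub>1_K[OF closed[OF e(2)]] by (simp add: mem_copies_iff K_simps)
    moreover have "n' (fst u \<otimes>\<^bsub>G\<^esub> g, snd u) = (fst (n' u) \<otimes>\<^bsub>G\<^esub> h, snd (n' u))"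
      if u: "u \<in> copies m K" for u
      using n\<^sub>1g[OF subsetD[OF copies_K_subset u]] by (simp add: n'_eq u closed[OF u])
    ultimately show ?thesis
      unfolding K_simps by blast
  qed
  then have "n' \<in> normalizer (BijGroup (copies m K)) (right_regular m K)"
    using bij' by (simp add: K.normalizer_right_regular_iff[OF finK] Bij_def n'_def)
  moreover have "image_graph n' (Cay m K S) = Cay m K T"
  proof -
    have "(u, v) \<in> parcs (Cay m K S) \<longleftrightarrow> (n' u, n' v) \<in> parcs (Cay m K T)"
      if u: "u \<in> copies m K" and v: "v \<in> copies m K" for u v
    proof -
      have uv: "u \<in> copies m G" "v \<in> copies m G"
        using u v copies_K_subset by auto
      show ?thesis
        using arc_extend_iff[OF S u uv(2)] arc_extend_iff[OF T n\<^sub>1_K[OF u] n\<^sub>1_in[OF uv(2)]]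
          n\<^sub>1_arc[OF uv] by (simp add: n'_eq u v)
    qed
    then show ?thesis
      using bij' by (simp add: K.Cay_image_eq_iff[OF S T bij'] graph_isomorphism_def)
  qed
  ultimately show "\<exists>n\<in>normalizer (BijGroup (copies m K)) (right_regular m K).
      image_graph n (Cay m K S) = \<Sigma>"
    using \<Sigma> by blast
qed

end

section \<open>Subgroups of groups with the property\<close>

theorem theorem5p5:
  fixes m :: nat and G :: "('a, 'b) monoid_scheme" and H :: "'a set"
  assumes "m \<ge> 3"
    and "group G" and "finite (carrier G)"
    and "mPCI_group m G"
    and "subgroup H G"
  shows "mPCI_group m (G\<lparr>carrier := H\<rparr>)"
proof -
  let ?K = "G\<lparr>carrier := H\<rparr>"
  interpret K: group ?K
    by (rule group.subgroup_imp_group[OF assms(2,5)])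
  have finK: "finite (carrier ?K)"
    using assms(3) subgroup.subset[OF assms(5)] by (auto intro: finite_subset)
  have connected: "mPCI_graph m ?K (Cay m ?K S)"
    if "connection_family m ?K S" "cut_connected (Cay m ?K S)" for S
    using cut_connected_imp_mPCI_graph[OF assms(2,5) _ assms(3,4) that] assms(1) by simp
  have "mPCI_graph m ?K (Cay m ?K S)" if S: "connection_family m ?K S" for S
    using K.Cay_or_complement_cut_connected[OF S assms(1)]
  proof
    assume "cut_connected (Cay m ?K S)"
    with S show ?thesis by (rule connected)
  next
    assume "cut_connected (Cay m ?K (co_connection ?K S))"
    then have "mPCI_graph m ?K (Cay m ?K (co_connection ?K S))"
      by (rule connected[OF K.connection_family_co_connection[OF S]])
    then show ?thesis
      by (rule K.mPCI_graph_of_co_connection[OF finK S])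
  qed
  then show ?thesis
    by (auto simp: mPCI_group_def mPCayley_graph_def)
qed

end
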